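(* Let $q\ge 2$ and let $I=(L^i(v))\subset S=k[x_1,\ldots,x_n]$ be the initial squarefree lexsegment ideal generated in degree $q$ determined by the monomial $v=x_{j_1}\cdots x_{j_q}$, with $2\leq j_1<\ldots<j_q\leq n$. For $1\leq t\leq q$ put $A_t=[j_t]\setminus\{j_1,\ldots,j_{t-1}\}$. Then $I$ has the minimal primary decomposition $$I=\left(\bigcap_{t=1}^{q}(x_i : i\in A_t)\right)\cap\left(\bigcap_{\substack{F\subset[n],\ |F|=q-1\\ F\cap A_t\neq\emptyset \text{ for all } 1\le t\le q}}P_{F^c}\right).$$
   Context: $k$ is a field, $S=k[x_1,\ldots,x_n]$, $[n]=\{1,\ldots,n\}$. Monomials are ordered lexicographically with $x_1>x_2>\cdots>x_n$. $\mathrm{Mon}_q^s(S)$ is the set of squarefree monomials of degree $q$ in $S$. For $v\in \mathrm{Mon}_q^s(S)$, $L^i(v)=\{w\in \mathrm{Mon}_q^s(S): w\geq_{lex} v\}$ is the initial squarefree lexsegment set of $v$, and the ideal $(L^i(v))$ it generates is an initial squarefree lexsegment ideal. For $A\subset[n]$, $P_A=(x_i: i\in A)$ and $A^c=[n]\setminus A$. Minimal primary decomposition means the irredundant intersection of the minimal primes of the (squarefree, hence radical) ideal $I$, each listed once. *)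

theory Defs
  imports "HOL-Library.Poly_Mapping" "HOL-Algebra.Ideal"
begin

text \<open>
  A monomial is identified with its exponent vector, of type \<^typ>\<open>nat \<Rightarrow>\<^sub>0 nat\<close>; the ring
  \<open>k[x\<^sub>1, \<dots>, x\<^sub>n]\<close> consists of the polynomials all of whose monomials involve only variables
  with index in \<open>{1..n}\<close>.
\<close>

type_synonym 'k mpol = "(nat \<Rightarrow>\<^sub>0 nat) \<Rightarrow>\<^sub>0 'k"

definition mpol_ring :: "nat \<Rightarrow> ('k::field) mpol ring" where
  "mpol_ring n =
     \<lparr>carrier = {p. \<forall>m\<in>Poly_Mapping.keys p. Poly_Mapping.keys m \<subseteq> {1..n}},
      mult = (*), one = 1, zero = 0, add = (+)\<rparr>"

definition mon :: "(nat \<Rightarrow>\<^sub>0 nat) \<Rightarrow> ('k::field) mpol" where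
  "mon m = Poly_Mapping.single m 1"

definition var :: "nat \<Rightarrow> ('k::field) mpol" where
  "var i = mon (Poly_Mapping.single i 1)"

definition sqfree_mons :: "nat \<Rightarrow> nat \<Rightarrow> (nat \<Rightarrow>\<^sub>0 nat) set" where
  "sqfree_mons n q =
     {m. Poly_Mapping.keys m \<subseteq> {1..n} \<and> (\<forall>i. Poly_Mapping.lookup m i \<le> 1) \<and>
         (\<Sum>i\<in>Poly_Mapping.keys m. Poly_Mapping.lookup m i) = q}"

text \<open>
  The library order on \<^typ>\<open>nat \<Rightarrow>\<^sub>0 nat\<close> compares the exponents at the smallest index where they
  differ, so it is the lexicographic order with \<open>x\<^sub>1 > x\<^sub>2 > \<dots>\<close>.
\<close>

definition initial_sqfree_lexseg :: "nat \<Rightarrow> nat \<Rightarrow> (nat \<Rightarrow>\<^sub>0 nat) \<Rightarrow> (nat \<Rightarrow>\<^sub>0 nat) set" where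
  "initial_sqfree_lexseg n q v = {w \<in> sqfree_mons n q. w \<ge> v}"

lemma lex_less_iff:
  fixes v w :: "nat \<Rightarrow>\<^sub>0 nat"
  shows "v < w \<longleftrightarrow> (\<exists>k. Poly_Mapping.lookup v k < Poly_Mapping.lookup w k \<and>
           (\<forall>k'<k. Poly_Mapping.lookup v k' = Poly_Mapping.lookup w k'))"
  by transfer (simp add: less_fun_def)

definition initial_sqfree_lexseg_ideal :: "nat \<Rightarrow> nat \<Rightarrow> (nat \<Rightarrow>\<^sub>0 nat) \<Rightarrow> ('k::field) mpol set" where
  "initial_sqfree_lexseg_ideal n q v = Idl\<^bsub>mpol_ring n\<^esub> (mon ` initial_sqfree_lexseg n q v)"

definition var_ideal :: "nat \<Rightarrow> nat set \<Rightarrow> ('k::field) mpol set" where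
  "var_ideal n A = Idl\<^bsub>mpol_ring n\<^esub> (var ` A)"

definition minimal_primes :: "('a, 'b) ring_scheme \<Rightarrow> 'a set \<Rightarrow> 'a set set" where
  "minimal_primes R I =
     {P. primeideal P R \<and> I \<subseteq> P \<and> (\<forall>Q. primeideal Q R \<and> I \<subseteq> Q \<and> Q \<subseteq> P \<longrightarrow> Q = P)}"

text \<open>
  For radical ideals: the family \<open>C\<close>, indexed by \<open>X\<close>, lists every minimal prime of \<open>I\<close> exactly
  once, and \<open>I\<close> is the irredundant intersection of the family.  The factor \<^term>\<open>carrier R\<close> gives
  the empty intersection its proper value.
\<close>

definition minimal_primary_decomposition ::
    "('a, 'b) ring_scheme \<Rightarrow> 'a set \<Rightarrow> 'i set \<Rightarrow> ('i \<Rightarrow> 'a set) \<Rightarrow> bool" where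
  "minimal_primary_decomposition R I X C \<longleftrightarrow>
     finite X \<and>
     inj_on C X \<and>
     C ` X = minimal_primes R I \<and>
     I = carrier R \<inter> (\<Inter>x\<in>X. C x) \<and>
     (\<forall>x\<in>X. I \<noteq> carrier R \<inter> (\<Inter>y\<in>X - {x}. C y))"

lemma cring_mpol_ring: "cring (mpol_ring n :: ('k::field) mpol ring)"
proof -
  let ?S = "{p :: 'k mpol. \<forall>m\<in>Poly_Mapping.keys p. Poly_Mapping.keys m \<subseteq> {1..n}}"
  have add: "p + q \<in> ?S" if "p \<in> ?S" "q \<in> ?S" for p q
    using that Poly_Mapping.keys_add[of p q] by blast
  have uminus: "- p \<in> ?S" if "p \<in> ?S" for p
    using that by simp
  have mult: "p * q \<in> ?S" if p: "p \<in> ?S" and q: "q \<in> ?S" for p q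
  proof -
    have "Poly_Mapping.keys m \<subseteq> {1..n}" if m: "m \<in> Poly_Mapping.keys (p * q)" for m
    proof -
      obtain a b where ab: "m = a + b" "a \<in> Poly_Mapping.keys p" "b \<in> Poly_Mapping.keys q"
        using m Poly_Mapping.keys_mult[of p q] by blast
      then have "Poly_Mapping.keys a \<subseteq> {1..n}" "Poly_Mapping.keys b \<subseteq> {1..n}"
        using p q by blast+
      then show ?thesis
        using ab(1) Poly_Mapping.keys_add[of a b] by blast
    qed
    then show ?thesis by blast
  qed
  have car: "carrier (mpol_ring n :: 'k mpol ring) = ?S"
    and ops: "x \<oplus>\<^bsub>mpol_ring n\<^esub> y = x + y" "x \<otimes>\<^bsub>mpol_ring n\<^esub> y = x * y"
      "\<zero>\<^bsub>mpol_ring n\<^esub> = (0 :: 'k mpol)" "\<one>\<^bsub>mpol_ring n\<^esub> = (1 :: 'k mpol)" for x y :: "'k mpol"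
    by (simp_all add: mpol_ring_def)
  have zero: "0 \<in> ?S" and one: "1 \<in> ?S"
    by simp_all
  show ?thesis
  proof (rule cringI)
    show "abelian_group (mpol_ring n :: 'k mpol ring)"
    proof (rule abelian_groupI, unfold car ops)
      fix x :: "'k mpol"
      assume "x \<in> ?S"
      then show "\<exists>y\<in>?S. y + x = 0"
        using uminus[of x] by (intro bexI[of _ "- x"]) simp_all
    qed (assumption | rule add zero add.assoc add.commute add_0)+
    show "comm_monoid (mpol_ring n :: 'k mpol ring)"
      by (rule comm_monoidI, unfold car ops)
        (assumption | rule mult one mult.assoc mult.commute mult_1)+
  qed (simp add: ops distrib_right)
qed

end

theory Submission
  imports Defs
begin

text \<open>
  An ideal generated by monomials consists of the polynomials all of whose monomials are multiples
  of generators, so membership in \<open>I\<close> and in the ideals \<open>P\<^sub>A\<close> is decided by the supports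
  \<open>W\<close> of monomials.  If \<open>W\<close> meets every \<open>A\<^sub>t\<close> and does not contain the support of \<open>v\<close>,
  let \<open>j\<^sub>s\<close> be the first index of \<open>v\<close> outside \<open>W\<close>; an element of \<open>W \<inter> A\<^sub>s\<close> lies
  below \<open>j\<^sub>s\<close> and off \<open>v\<close>, so every \<open>q\<close>-subset of \<open>W\<close> containing it and
  \<open>j\<^sub>1, \<dots>, j\<^sub>s\<^sub>-\<^sub>1\<close> is lexicographically larger than \<open>v\<close>.  Such a subset exists
  unless \<open>|W| < q\<close>, and then \<open>W\<close> is contained in one of the sets \<open>F\<close>.  The sets
  \<open>A\<^sub>t\<close> and \<open>F\<^sup>c\<close> form an antichain (compare cardinalities for \<open>F\<^sup>c \<subseteq> A\<^sub>t\<close>), and an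
  irredundant finite intersection of primes consists of the minimal primes.
\<close>

section \<open>Intersections of prime ideals\<close>

text \<open>Otherwise each \<open>C x\<close> has an element outside \<open>Q\<close>; the product
  of these elements lies in every \<open>C x\<close>, but by primality not in \<open>Q\<close>. For
  empty \<open>X\<close> the claim rests on \<open>Q\<close> being proper.\<close>

lemma prime_above_Inter:
  fixes R (structure)
  assumes Q: "primeideal Q R" and "finite X" and id: "\<And>x. x \<in> X \<Longrightarrow> ideal (C x) R"
    and sub: "carrier R \<inter> (\<Inter>x\<in>X. C x) \<subseteq> Q"
  shows "\<exists>x\<in>X. C x \<subseteq> Q"
proof (rule ccontr)
  interpret Q: primeideal Q R by (rule Q)
  assume "\<not> (\<exists>x\<in>X. C x \<subseteq> Q)"
  then have no: "\<And>x. x \<in> X \<Longrightarrow> \<not> C x \<subseteq> Q" by blast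
  from \<open>finite X\<close> id no have "\<exists>a\<in>carrier R. a \<in> (\<Inter>x\<in>X. C x) \<and> a \<notin> Q"
  proof (induction X rule: finite_induct)
    case empty
    show ?case
      using Q.I_notcarr Q.a_subset by auto
  next
    case (insert y X)
    then obtain a where a: "a \<in> carrier R" "a \<in> (\<Inter>x\<in>X. C x)" "a \<notin> Q" by auto
    obtain b where b: "b \<in> C y" "b \<notin> Q" using insert.prems(2)[of y] by auto
    have iy: "ideal (C y) R" using insert.prems(1) by simp
    have bc: "b \<in> carrier R"
      using iy b(1) by (meson additive_subgroup.a_Hcarr ideal.axioms(1))
    have "a \<otimes> b \<in> C y" using ideal.I_l_closed[OF iy b(1) a(1)] .
    moreover have "a \<otimes> b \<in> C x" if "x \<in> X" for x
      using ideal.I_r_closed[of "C x" R a b] insert.prems(1)[of x] a bc that by auto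
    moreover have "a \<otimes> b \<notin> Q" using Q.I_prime[OF a(1) bc] a(3) b(2) by blast
    ultimately show ?case using a(1) bc by (intro bexI[of _ "a \<otimes> b"]) auto
  qed
  then show False using sub by blast
qed

text \<open>Every prime above \<open>I\<close> contains some \<open>C x\<close>. Hence minimal
  primes are among the \<open>C x\<close>, and the antichain condition makes each \<open>C x\<close>
  minimal. If \<open>x\<close> could be omitted, the prime \<open>C x\<close> would contain another
  \<open>C y\<close>.\<close>

lemma minimal_primary_decompositionI:
  fixes R (structure)
  assumes fin: "finite X" and prime: "\<And>x. x \<in> X \<Longrightarrow> primeideal (C x) R"
    and antichain: "\<And>x y. x \<in> X \<Longrightarrow> y \<in> X \<Longrightarrow> C x \<subseteq> C y \<Longrightarrow> x = y"
    and I: "I = carrier R \<inter> (\<Inter>x\<in>X. C x)"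
  shows "minimal_primary_decomposition R I X C"
proof -
  have id: "ideal (C x) R" if "x \<in> X" for x
    using prime[OF that] by (rule primeideal.axioms(1))
  have I_sub: "I \<subseteq> C x" if "x \<in> X" for x
    using that I by blast
  have above: "\<exists>x\<in>X. C x \<subseteq> Q" if "primeideal Q R" "I \<subseteq> Q" for Q
    using prime_above_Inter[OF that(1) fin, of C] id that(2) I by blast
  have "C ` X = minimal_primes R I"
  proof (intro equalityI subsetI)
    fix P assume "P \<in> C ` X"
    then obtain x where x: "x \<in> X" "P = C x" by blast
    have "Q = P" if "primeideal Q R" "I \<subseteq> Q" "Q \<subseteq> P" for Q
      using above[OF that(1,2)] that(3) antichain x by (metis subset_antisym subset_trans)
    then show "P \<in> minimal_primes R I"
      unfolding minimal_primes_def using prime[OF x(1)] I_sub[OF x(1)] x(2) by blast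
  next
    fix P assume P: "P \<in> minimal_primes R I"
    then obtain x where "x \<in> X" "C x \<subseteq> P"
      using above unfolding minimal_primes_def by blast
    then show "P \<in> C ` X"
      using P prime I_sub unfolding minimal_primes_def by blast
  qed
  moreover have "inj_on C X"
    using antichain by (intro inj_onI) simp
  moreover have "I \<noteq> carrier R \<inter> (\<Inter>y\<in>X - {x}. C y)" if x: "x \<in> X" for x
  proof
    assume eq: "I = carrier R \<inter> (\<Inter>y\<in>X - {x}. C y)"
    have "\<exists>y\<in>X - {x}. C y \<subseteq> C x"
      using prime_above_Inter[OF prime[OF x], of "X - {x}" C] fin id I_sub[OF x] eq by auto
    then show False using antichain x by blast
  qed
  ultimately show ?thesis
    unfolding minimal_primary_decomposition_def using fin I by blast
qed

section \<open>Monomial ideals\<close>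

lemma mpol_ring_simps:
  "carrier (mpol_ring n :: ('k::field) mpol ring) =
     {p. \<forall>m\<in>Poly_Mapping.keys p. Poly_Mapping.keys m \<subseteq> {1..n}}"
  "x \<oplus>\<^bsub>mpol_ring n\<^esub> y = x + y" "x \<otimes>\<^bsub>mpol_ring n\<^esub> y = x * y"
  "\<zero>\<^bsub>mpol_ring n\<^esub> = (0 :: 'k mpol)" "\<one>\<^bsub>mpol_ring n\<^esub> = (1 :: 'k mpol)"
  by (simp_all add: mpol_ring_def)

lemma keys_add_nat:
  "Poly_Mapping.keys (a + b) = Poly_Mapping.keys a \<union> Poly_Mapping.keys (b :: 'a \<Rightarrow>\<^sub>0 nat)"
  by (auto simp: in_keys_iff lookup_add)

lemma poly_mapping_eq_sum_single:
  fixes p :: "'a \<Rightarrow>\<^sub>0 'b::comm_monoid_add"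
  shows "p = (\<Sum>m\<in>Poly_Mapping.keys p. Poly_Mapping.single m (Poly_Mapping.lookup p m))"
proof (rule poly_mapping_eqI)
  fix k
  show "Poly_Mapping.lookup p k =
    Poly_Mapping.lookup (\<Sum>m\<in>Poly_Mapping.keys p. Poly_Mapping.single m (Poly_Mapping.lookup p m)) k"
    by (simp add: lookup_sum lookup_single when_def in_keys_iff)
qed

text \<open>For the primality proof: with \<open>T\<close> the monomials of a monomial ideal,
  \<open>p1\<close> is the part of \<open>p\<close> in the ideal and \<open>p0\<close> the reduced
  remainder.\<close>

lemma poly_mapping_split_keys:
  fixes p :: "'a \<Rightarrow>\<^sub>0 'b::comm_monoid_add"
  obtains p0 p1 where "p = p0 + p1"
    "Poly_Mapping.keys p0 = Poly_Mapping.keys p - T" "Poly_Mapping.keys p1 = Poly_Mapping.keys p \<inter> T"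
proof -
  define part where "part B = (\<Sum>m\<in>Poly_Mapping.keys p \<inter> B.
      Poly_Mapping.single m (Poly_Mapping.lookup p m))" for B
  have look: "Poly_Mapping.lookup (part B) k = (if k \<in> B then Poly_Mapping.lookup p k else 0)" for B k
    by (auto simp: part_def lookup_sum lookup_single when_def in_keys_iff)
  have "p = part (- T) + part T"
    by (rule poly_mapping_eqI) (simp add: lookup_add look)
  moreover have "Poly_Mapping.keys (part (- T)) = Poly_Mapping.keys p - T"
    "Poly_Mapping.keys (part T) = Poly_Mapping.keys p \<inter> T"
    by (auto simp: in_keys_iff look split: if_splits)
  ultimately show ?thesis by (rule that)
qed

text \<open>Adding exponent vectors multiplies monomials. The cofactor \<open>u\<close> may involve
  any variables; the restriction to the first \<open>n\<close> comes from intersecting with the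
  carrier.\<close>

definition multiples :: "(nat \<Rightarrow>\<^sub>0 nat) set \<Rightarrow> (nat \<Rightarrow>\<^sub>0 nat) set" where
  "multiples M = {w + u | w u. w \<in> M}"

lemma multiples_add: "m \<in> multiples M \<Longrightarrow> m + u \<in> multiples M"
  unfolding multiples_def by (force simp: add.assoc)

lemma ideal_keys_multiples:
  "ideal {p \<in> carrier (mpol_ring n). Poly_Mapping.keys p \<subseteq> multiples M}
     (mpol_ring n :: ('k::field) mpol ring)" (is "ideal ?J ?R")
proof -
  interpret R: cring ?R by (rule cring_mpol_ring)
  have mult: "x \<otimes>\<^bsub>?R\<^esub> a \<in> ?J" if a: "a \<in> ?J" and x: "x \<in> carrier ?R" for a x
  proof -
    have "m \<in> multiples M" if "m \<in> Poly_Mapping.keys (x * a)" for m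
    proof -
      obtain b c where "m = b + c" "c \<in> Poly_Mapping.keys a"
        using \<open>m \<in> _\<close> Poly_Mapping.keys_mult[of x a] by blast
      then show ?thesis using a multiples_add[of c M b] by (auto simp: add.commute)
    qed
    moreover have "x \<otimes>\<^bsub>?R\<^esub> a \<in> carrier ?R" using a x by auto
    ultimately show ?thesis by (auto simp: mpol_ring_simps(3))
  qed
  show ?thesis
  proof (rule idealI)
    show "subgroup ?J (add_monoid ?R)"
    proof (rule R.add.subgroupI)
      have "0 \<in> ?J" by (simp add: mpol_ring_simps)
      then show "?J \<noteq> {}" by blast
      \<comment> \<open>Negation is multiplication by minus one, so closure under ring multiples
        covers it.\<close>
      show "\<ominus>\<^bsub>?R\<^esub> a \<in> ?J" if "a \<in> ?J" for a
        using mult[OF that, of "\<ominus>\<^bsub>?R\<^esub> \<one>\<^bsub>?R\<^esub>"] that R.l_minus[of "\<one>\<^bsub>?R\<^esub>" a] by simp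
      show "a \<oplus>\<^bsub>?R\<^esub> b \<in> ?J" if "a \<in> ?J" "b \<in> ?J" for a b
      proof -
        have "a \<oplus>\<^bsub>?R\<^esub> b \<in> carrier ?R" using that by auto
        then show ?thesis
          using that Poly_Mapping.keys_add[of a b] by (auto simp: mpol_ring_simps(2))
      qed
    qed auto
    show "a \<otimes>\<^bsub>?R\<^esub> x \<in> ?J" if "a \<in> ?J" "x \<in> carrier ?R" for a x
      using mult[OF that] that R.m_comm[of a x] by simp
  qed (use mult R.ring_axioms in auto)
qed

text \<open>The right side is an ideal containing the generators. Conversely, a polynomial is the
  sum of its terms, and each term is a generator times a term of the ring.\<close>

lemma monomial_ideal_eq:
  assumes M: "\<And>m. m \<in> M \<Longrightarrow> Poly_Mapping.keys m \<subseteq> {1..n}"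
  shows "Idl\<^bsub>mpol_ring n\<^esub> (mon ` M) =
    {p \<in> carrier (mpol_ring n :: ('k::field) mpol ring). Poly_Mapping.keys p \<subseteq> multiples M}"
    (is "?I = ?J")
proof
  let ?R = "mpol_ring n :: 'k mpol ring"
  interpret R: cring ?R by (rule cring_mpol_ring)
  have "mon ` M \<subseteq> ?J"
  proof
    fix p :: "'k mpol" assume "p \<in> mon ` M"
    then obtain m where "m \<in> M" "p = mon m" by blast
    moreover have "m + 0 \<in> multiples M" using \<open>m \<in> M\<close> unfolding multiples_def by blast
    ultimately show "p \<in> ?J" using M[of m] by (simp add: mon_def mpol_ring_simps)
  qed
  then show "?I \<subseteq> ?J" by (rule R.genideal_minimal[OF ideal_keys_multiples])
  have M_carr: "mon ` M \<subseteq> carrier ?R"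
    using M by (simp add: mon_def mpol_ring_simps image_subset_iff)
  interpret I: ideal ?I ?R by (rule R.genideal_ideal[OF M_carr])
  have term_in: "Poly_Mapping.single m c \<in> ?I"
    if m: "m \<in> multiples M" "Poly_Mapping.keys m \<subseteq> {1..n}" for m and c :: 'k
  proof -
    obtain w u where wu: "m = w + u" "w \<in> M" using m(1) unfolding multiples_def by blast
    have "mon w \<in> ?I" using R.genideal_self[OF M_carr] wu(2) by blast
    \<comment> \<open>Natural exponents cannot cancel, so \<open>u\<close> uses only variables that
      occur in \<open>m\<close>.\<close>
    moreover have "Poly_Mapping.single u c \<in> carrier ?R"
      using m(2) wu(1) by (simp add: mpol_ring_simps keys_add_nat)
    ultimately have "mon w \<otimes>\<^bsub>?R\<^esub> Poly_Mapping.single u c \<in> ?I" by (rule I.I_r_closed)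
    then show ?thesis by (simp add: mpol_ring_simps mon_def mult_single wu(1))
  qed
  show "?J \<subseteq> ?I"
  proof
    fix p assume p: "p \<in> ?J"
    have "(\<Sum>m\<in>B. Poly_Mapping.single m (Poly_Mapping.lookup p m)) \<in> ?I"
      if "finite B" "B \<subseteq> Poly_Mapping.keys p" for B
      using that
    proof (induction B rule: finite_induct)
      case empty
      show ?case using I.zero_closed by (simp add: mpol_ring_simps)
    next
      case (insert m B)
      have "Poly_Mapping.single m (Poly_Mapping.lookup p m) \<in> ?I"
        using p insert.prems by (intro term_in) (auto simp: mpol_ring_simps)
      then show ?case
        using insert I.a_closed by (simp add: mpol_ring_simps)
    qed
    from this[of "Poly_Mapping.keys p"] show "p \<in> ?I"
      using poly_mapping_eq_sum_single[of p] by simp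
  qed
qed

section \<open>Ideals generated by variables\<close>

lemma var_ideal_eq:
  assumes "A \<subseteq> {1..n}"
  shows "var_ideal n A = {p \<in> carrier (mpol_ring n :: ('k::field) mpol ring).
    Poly_Mapping.keys p \<subseteq> {m. Poly_Mapping.keys m \<inter> A \<noteq> {}}}"
proof -
  let ?M = "(\<lambda>i. Poly_Mapping.single i (1::nat)) ` A"
  have "multiples ?M = {m. Poly_Mapping.keys m \<inter> A \<noteq> {}}"
  proof (intro equalityI subsetI)
    fix m :: "nat \<Rightarrow>\<^sub>0 nat" assume "m \<in> {m. Poly_Mapping.keys m \<inter> A \<noteq> {}}"
    then obtain i where i: "i \<in> Poly_Mapping.keys m" "i \<in> A" by blast
    \<comment> \<open>The truncated subtraction loses nothing, since \<open>i\<close> has exponent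
      at least 1 in \<open>m\<close>.\<close>
    have "m = Poly_Mapping.single i 1 + (m - Poly_Mapping.single i 1)"
      using i(1)
      by (intro poly_mapping_eqI) (auto simp: lookup_add lookup_minus lookup_single when_def in_keys_iff)
    then show "m \<in> multiples ?M" using i(2) unfolding multiples_def by blast
  qed (auto simp: multiples_def keys_add_nat)
  moreover have "var ` A = (mon ` ?M :: 'k mpol set)" by (auto simp: var_def image_image)
  moreover have "Poly_Mapping.keys m \<subseteq> {1..n}" if "m \<in> ?M" for m
    using that assms by auto
  ultimately show ?thesis
    unfolding var_ideal_def using monomial_ideal_eq[of ?M n] by simp
qed

text \<open>Discarding the terms in the ideal leaves parts \<open>p0\<close> and \<open>r0\<close>
  free of variables from \<open>A\<close>, and so is their product. If \<open>p * r\<close> is in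
  the ideal, then so is \<open>p0 * r0\<close>; hence this product vanishes, and one of the factors
  is zero.\<close>

lemma primeideal_var_ideal:
  assumes A: "A \<subseteq> {1..n}"
  shows "primeideal (var_ideal n A) (mpol_ring n :: ('k::field) mpol ring)"
proof -
  let ?R = "mpol_ring n :: 'k mpol ring"
  let ?T = "{m :: nat \<Rightarrow>\<^sub>0 nat. Poly_Mapping.keys m \<inter> A \<noteq> {}}"
  interpret R: cring ?R by (rule cring_mpol_ring)
  have id: "ideal (var_ideal n A) ?R"
    unfolding var_ideal_def
    using A by (intro R.genideal_ideal) (auto simp: var_def mon_def mpol_ring_simps)
  show ?thesis
  proof (rule primeidealI[OF id R.is_cring])
    have "1 \<in> carrier ?R" "1 \<notin> (var_ideal n A :: 'k mpol set)"
      by (auto simp: var_ideal_eq[OF A] mpol_ring_simps)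
    then show "carrier ?R \<noteq> var_ideal n A" by blast
  next
    fix p r assume p: "p \<in> carrier ?R" and r: "r \<in> carrier ?R" and "p \<otimes>\<^bsub>?R\<^esub> r \<in> var_ideal n A"
    then have pr: "Poly_Mapping.keys (p * r) \<subseteq> ?T"
      by (auto simp: var_ideal_eq[OF A] mpol_ring_simps(3))
    obtain p0 p1 where p01: "p = p0 + p1" "Poly_Mapping.keys p0 = Poly_Mapping.keys p - ?T"
      "Poly_Mapping.keys p1 = Poly_Mapping.keys p \<inter> ?T" by (rule poly_mapping_split_keys)
    obtain r0 r1 where r01: "r = r0 + r1" "Poly_Mapping.keys r0 = Poly_Mapping.keys r - ?T"
      "Poly_Mapping.keys r1 = Poly_Mapping.keys r \<inter> ?T" by (rule poly_mapping_split_keys)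
    have T_left: "Poly_Mapping.keys (a * b) \<subseteq> ?T" if "Poly_Mapping.keys a \<subseteq> ?T" for a b :: "'k mpol"
      using that Poly_Mapping.keys_mult[of a b] by (fastforce simp: keys_add_nat)
    have "p0 * r0 = p * r - (p1 * r + r1 * p0)"
      by (simp add: p01(1) r01(1) algebra_simps)
    moreover have "Poly_Mapping.keys (p1 * r) \<subseteq> ?T" "Poly_Mapping.keys (r1 * p0) \<subseteq> ?T"
      by (rule T_left, simp add: p01(3) r01(3))+
    ultimately have "Poly_Mapping.keys (p0 * r0) \<subseteq> ?T"
      using pr keys_diff[of "p * r" "p1 * r + r1 * p0"] Poly_Mapping.keys_add[of "p1 * r" "r1 * p0"]
      by (simp only:) blast
    moreover have "Poly_Mapping.keys (p0 * r0) \<inter> ?T = {}"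
      using p01(2) r01(2) Poly_Mapping.keys_mult[of p0 r0] by (fastforce simp: keys_add_nat)
    ultimately have "p0 * r0 = 0"
      by (metis Int_absorb2 keys_eq_empty)
    then have "p0 = 0 \<or> r0 = 0" by simp
    then have "Poly_Mapping.keys p \<subseteq> ?T \<or> Poly_Mapping.keys r \<subseteq> ?T"
      using p01(2) r01(2) by (metis Diff_eq_empty_iff keys_zero)
    then show "p \<in> var_ideal n A \<or> r \<in> var_ideal n A"
      using p r unfolding var_ideal_eq[OF A] by blast
  qed
qed

text \<open>Inclusion is tested on the variables themselves. This reduces comparing the components
  to comparing their index sets.\<close>

lemma var_ideal_subset_iff:
  assumes "A \<subseteq> {1..n}" "B \<subseteq> {1..n}"
  shows "(var_ideal n A :: ('k::field) mpol set) \<subseteq> var_ideal n B \<longleftrightarrow> A \<subseteq> B"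
proof
  assume sub: "(var_ideal n A :: 'k mpol set) \<subseteq> var_ideal n B"
  show "A \<subseteq> B"
  proof
    fix i assume "i \<in> A"
    then have "(var i :: 'k mpol) \<in> var_ideal n A"
      using assms(1) by (auto simp: var_ideal_eq var_def mon_def mpol_ring_simps)
    then have "(var i :: 'k mpol) \<in> var_ideal n B" using sub by blast
    then show "i \<in> B" using assms(2) by (simp add: var_ideal_eq var_def mon_def)
  qed
next
  assume "A \<subseteq> B"
  then show "(var_ideal n A :: 'k mpol set) \<subseteq> var_ideal n B"
    unfolding var_ideal_eq[OF assms(1)] var_ideal_eq[OF assms(2)] by blast
qed

section \<open>Supports of squarefree monomials in a lexsegment\<close>

lemma lookup_sum_single:
  assumes "finite W"
  shows "Poly_Mapping.lookup (\<Sum>i\<in>W. Poly_Mapping.single i (1::nat)) k = of_bool (k \<in> W)"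
  using assms by (simp add: lookup_sum lookup_single when_def)

text \<open>All exponents on the support equal 1, so a squarefree monomial is determined by its
  support, whose size is the degree.\<close>

lemma sqfree_mons_eq:
  "sqfree_mons n q = (\<lambda>W. \<Sum>i\<in>W. Poly_Mapping.single i 1) ` {W. W \<subseteq> {1..n} \<and> card W = q}"
proof (intro equalityI subsetI)
  fix m assume m: "m \<in> sqfree_mons n q"
  let ?W = "Poly_Mapping.keys m"
  have one: "Poly_Mapping.lookup m i = 1" if "i \<in> ?W" for i
    using m that unfolding sqfree_mons_def in_keys_iff by (auto intro: le_antisym simp: Suc_le_eq)
  have "m = (\<Sum>i\<in>?W. Poly_Mapping.single i 1)"
    using one by (subst poly_mapping_eq_sum_single) simp
  moreover have "card ?W = q"
    using m one by (simp add: sqfree_mons_def)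
  moreover have "?W \<subseteq> {1..n}" using m by (simp add: sqfree_mons_def)
  ultimately show "m \<in> (\<lambda>W. \<Sum>i\<in>W. Poly_Mapping.single i 1) ` {W. W \<subseteq> {1..n} \<and> card W = q}"
    by blast
next
  fix m assume "m \<in> (\<lambda>W. \<Sum>i\<in>W. Poly_Mapping.single i (1::nat)) ` {W. W \<subseteq> {1..n} \<and> card W = q}"
  then obtain W where W: "m = (\<Sum>i\<in>W. Poly_Mapping.single i 1)" "W \<subseteq> {1..n}" "card W = q"
    by blast
  have "finite W" using W(2) finite_subset by blast
  then have look: "Poly_Mapping.lookup m k = of_bool (k \<in> W)" for k
    unfolding W(1) by (rule lookup_sum_single)
  then have "Poly_Mapping.keys m = W" by (auto simp: in_keys_iff)
  then show "m \<in> sqfree_mons n q"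
    using W(2,3) look by (simp add: sqfree_mons_def)
qed

text \<open>The witness \<open>k\<close> is the first index where the two 0/1 exponent vectors
  differ; the larger vector has its 1 there.\<close>

lemma sum_single_le_iff:
  fixes U V :: "nat set"
  assumes "finite V" "finite U"
  shows "(\<Sum>i\<in>V. Poly_Mapping.single i (1::nat)) \<le> (\<Sum>i\<in>U. Poly_Mapping.single i 1) \<longleftrightarrow>
    U = V \<or> (\<exists>k\<in>U - V. U \<inter> {..<k} = V \<inter> {..<k})"
    (is "?v \<le> ?u \<longleftrightarrow> _")
proof -
  have "?v = ?u \<longleftrightarrow> U = V"
    unfolding poly_mapping_eq_iff fun_eq_iff
      lookup_sum_single[OF assms(1)] lookup_sum_single[OF assms(2)] of_bool_eq_iff by blast
  moreover have "?v < ?u \<longleftrightarrow> (\<exists>k\<in>U - V. U \<inter> {..<k} = V \<inter> {..<k})"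
  proof -
    have "of_bool (k \<in> V) < (of_bool (k \<in> U) :: nat) \<longleftrightarrow> k \<in> U - V" for k by auto
    moreover have "(\<forall>i<k. of_bool (i \<in> V) = (of_bool (i \<in> U) :: nat)) \<longleftrightarrow>
        U \<inter> {..<k} = V \<inter> {..<k}" for k
      unfolding of_bool_eq_iff by blast
    ultimately show ?thesis
      unfolding lex_less_iff lookup_sum_single[OF assms(1)] lookup_sum_single[OF assms(2)]
      by (simp only: Bex_def)
  qed
  ultimately show ?thesis unfolding le_less by (simp only: disj_commute)
qed

text \<open>\<open>U\<close> is the support of a lexsegment generator dividing \<open>m\<close>. A
  squarefree monomial divides \<open>m\<close> exactly when its support lies in that of
  \<open>m\<close>.\<close>

lemma mem_multiples_sqfree_iff:
  assumes "finite V"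
  shows "m \<in> multiples (initial_sqfree_lexseg n q (\<Sum>i\<in>V. Poly_Mapping.single i 1)) \<longleftrightarrow>
    (\<exists>U. U \<subseteq> {1..n} \<inter> Poly_Mapping.keys m \<and> card U = q \<and>
       (U = V \<or> (\<exists>k\<in>U - V. U \<inter> {..<k} = V \<inter> {..<k})))"
    (is "?L \<longleftrightarrow> ?R")
proof
  assume ?L
  then obtain w u where wu: "m = w + u"
    "w \<in> initial_sqfree_lexseg n q (\<Sum>i\<in>V. Poly_Mapping.single i 1)"
    unfolding multiples_def by blast
  then obtain U where U: "w = (\<Sum>i\<in>U. Poly_Mapping.single i 1)" "U \<subseteq> {1..n}" "card U = q"
    unfolding initial_sqfree_lexseg_def sqfree_mons_eq by blast
  have fin: "finite U" using U(2) finite_subset by blast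
  have "U \<subseteq> Poly_Mapping.keys m"
    unfolding wu(1) U(1) keys_add_nat using lookup_sum_single[OF fin] by (auto simp: in_keys_iff)
  moreover have "U = V \<or> (\<exists>k\<in>U - V. U \<inter> {..<k} = V \<inter> {..<k})"
    using wu(2) sum_single_le_iff[OF assms fin] unfolding U(1) initial_sqfree_lexseg_def by simp
  ultimately show ?R using U(2,3) by blast
next
  assume ?R
  then obtain U where U: "U \<subseteq> {1..n} \<inter> Poly_Mapping.keys m" "card U = q"
    "U = V \<or> (\<exists>k\<in>U - V. U \<inter> {..<k} = V \<inter> {..<k})" by blast
  let ?u = "\<Sum>i\<in>U. Poly_Mapping.single i (1::nat)"
  have fin: "finite U" using U(1) finite_subset by blast
  have "?u \<in> initial_sqfree_lexseg n q (\<Sum>i\<in>V. Poly_Mapping.single i 1)"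
    using U sum_single_le_iff[OF assms fin]
    unfolding initial_sqfree_lexseg_def sqfree_mons_eq by blast
  moreover have "m = ?u + (m - ?u)"
  proof (rule poly_mapping_eqI)
    fix k
    have "of_bool (k \<in> U) \<le> Poly_Mapping.lookup m k"
      using U(1) by (auto simp: in_keys_iff Suc_le_eq of_bool_def)
    then show "Poly_Mapping.lookup m k = Poly_Mapping.lookup (?u + (m - ?u)) k"
      unfolding lookup_add lookup_minus lookup_sum_single[OF fin] by simp
  qed
  ultimately show ?L unfolding multiples_def by blast
qed

text \<open>The combinatorial form of the decomposition: the left side says that monomials with
  support \<open>W\<close> lie in the lexsegment ideal, the right side that they lie in every
  component.\<close>

lemma lexseg_support_iff:
  fixes j :: "nat \<Rightarrow> nat"
  assumes mono: "strict_mono_on {1..q} j" and j1: "1 \<le> j 1" and q: "1 \<le> q" and jq: "j q \<le> n"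
    and A: "\<And>t. t \<in> {1..q} \<Longrightarrow> A t = {1..j t} - j ` {1..<t}"
    and Fs: "Fs = {F. F \<subseteq> {1..n} \<and> card F = q - 1 \<and> (\<forall>t\<in>{1..q}. F \<inter> A t \<noteq> {})}"
    and V: "V = j ` {1..q}" and W: "W \<subseteq> {1..n}"
  shows "(\<exists>U. U \<subseteq> W \<and> card U = q \<and> (U = V \<or> (\<exists>k\<in>U - V. U \<inter> {..<k} = V \<inter> {..<k}))) \<longleftrightarrow>
    (\<forall>t\<in>{1..q}. W \<inter> A t \<noteq> {}) \<and> (\<forall>F\<in>Fs. W \<inter> ({1..n} - F) \<noteq> {})" (is "?L \<longleftrightarrow> ?R")
proof -
  have less: "j s < j t \<longleftrightarrow> s < t" if "s \<in> {1..q}" "t \<in> {1..q}" for s t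
    using strict_mono_on_less[OF mono that] .
  have inj: "inj_on j {1..q}" using mono by (rule strict_mono_on_imp_inj_on)
  have cardV: "card V = q" unfolding V using inj by (simp add: card_image)
  have j_pos: "1 \<le> j t" if "t \<in> {1..q}" for t
    using less[of 1 t] j1 q that by (cases "t = 1") auto
  have j_A: "j t \<in> A t" if t: "t \<in> {1..q}" for t
    using j_pos[OF t] less[OF _ t] t by (fastforce simp: A[OF t])
  have finW: "finite W" using W finite_subset by blast
  show ?thesis
  proof
    assume ?L
    then obtain U where U: "U \<subseteq> W" "card U = q"
      "U = V \<or> (\<exists>k\<in>U - V. U \<inter> {..<k} = V \<inter> {..<k})" by blast
    have "W \<inter> A t \<noteq> {}" if t: "t \<in> {1..q}" for t
    proof (cases "j t \<in> U")
      case True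
      then show ?thesis using j_A[OF t] U(1) by blast
    next
      case False
      have "j t \<in> V" using t V by blast
      then obtain k where k: "k \<in> U" "k \<notin> V" "U \<inter> {..<k} = V \<inter> {..<k}"
        using False U(3) by blast
      \<comment> \<open>Below \<open>k\<close> the sets \<open>U\<close> and \<open>V\<close> agree,
        whereas \<open>j t\<close> is in \<open>V\<close> but not in \<open>U\<close>. So
        \<open>k\<close> itself is the required element of \<open>A t\<close>.\<close>
      have "k \<le> j t" using k(3) \<open>j t \<in> V\<close> False by (metis IntD1 IntI lessThan_iff not_le)
      moreover have "1 \<le> k" using k(1) U(1) W by auto
      moreover have "k \<notin> j ` {1..<t}" using k(2) t unfolding V by auto
      ultimately show ?thesis using A[OF t] k(1) U(1) by auto
    qed
    moreover have "W \<inter> ({1..n} - F) \<noteq> {}" if "F \<in> Fs" for F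
    proof
      assume "W \<inter> ({1..n} - F) = {}"
      then have "U \<subseteq> F" using U(1) W by blast
      moreover have "finite F" "card F = q - 1" using that Fs finite_subset by auto
      ultimately show False using card_mono[of F U] U(2) q by simp
    qed
    ultimately show ?R by blast
  next
    assume R: ?R
    show ?L
    proof (cases "V \<subseteq> W")
      case True
      then show ?thesis using cardV by blast
    next
      case False
      then have "\<exists>s. s \<in> {1..q} \<and> j s \<notin> W" unfolding V by blast
      define s where "s = (LEAST s. s \<in> {1..q} \<and> j s \<notin> W)"
      have s: "s \<in> {1..q}" "j s \<notin> W"
        using LeastI_ex[OF \<open>\<exists>s. s \<in> {1..q} \<and> j s \<notin> W\<close>] unfolding s_def by auto
      have before: "j r \<in> W" if "r \<in> {1..<s}" for r
        using not_less_Least[of r "\<lambda>s. s \<in> {1..q} \<and> j s \<notin> W"] that s(1) unfolding s_def[symmetric] by auto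
      obtain k where k: "k \<in> W" "k \<in> A s" using R s(1) by blast
      have kj: "k < j s" using k s A[OF s(1)] by (cases "k = j s") auto
      \<comment> \<open>The elements of \<open>V\<close> below \<open>j s\<close> are the
        \<open>j r\<close> with \<open>r < s\<close>, and these are removed from
        \<open>A s\<close>.\<close>
      have kV: "k \<notin> V"
        using kj k(2) A[OF s(1)] less[OF _ s(1)] unfolding V by auto
      \<comment> \<open>A smaller \<open>W\<close> could be enlarged to a set \<open>F\<close> of
        size \<open>q - 1\<close>. It meets every \<open>A t\<close> because \<open>W\<close> does,
        so it belongs to \<open>Fs\<close>, yet \<open>W\<close> misses its complement.\<close>
      have cardW: "q \<le> card W"
      proof (rule ccontr)
        assume "\<not> q \<le> card W"
        moreover have "q - 1 \<le> card {1..n}"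
        proof -
          have "V \<subseteq> {1..n}"
          proof
            fix i assume "i \<in> V"
            then obtain t where t: "t \<in> {1..q}" "i = j t" unfolding V by blast
            then show "i \<in> {1..n}"
              using j_pos[OF t(1)] less[OF t(1), of q] jq q by (cases "t = q") auto
          qed
          then show ?thesis using card_mono[of "{1..n}" V] cardV by simp
        qed
        ultimately obtain F where F: "W \<subseteq> F" "F \<subseteq> {1..n}" "card F = q - 1"
          using exists_subset_between[of W "q - 1" "{1..n}"] W by fastforce
        then have "F \<in> Fs" unfolding Fs using R by blast
        then show False using R F(1) by blast
      qed
      let ?B = "insert k (j ` {1..<s})"
      have "card ?B \<le> Suc (card (j ` {1..<s}))" by (rule card_insert_le_m1) auto
      also have "\<dots> \<le> q" using card_image_le[of "{1..<s}" j] s(1) by auto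
      finally have "card ?B \<le> q" .
      moreover have "?B \<subseteq> W" using k(1) before by blast
      ultimately obtain U where U: "?B \<subseteq> U" "U \<subseteq> W" "card U = q"
        using exists_subset_between[of ?B q W] cardW finW by blast
      \<comment> \<open>The completion of \<open>?B\<close> to \<open>U\<close> may add elements
        below \<open>k\<close>, so the first difference \<open>d\<close> from \<open>V\<close> need
        not be \<open>k\<close>; only \<open>d \<le> k\<close> is certain.\<close>
      define d where "d = (LEAST d. (d \<in> U) \<noteq> (d \<in> V))"
      have kd: "(k \<in> U) \<noteq> (k \<in> V)" using U(1) kV by blast
      have d: "(d \<in> U) \<noteq> (d \<in> V)" unfolding d_def using kd by (rule LeastI)
      have dk: "d \<le> k" unfolding d_def using kd by (rule Least_le)
      have below: "U \<inter> {..<d} = V \<inter> {..<d}"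
        using not_less_Least[of _ "\<lambda>d. (d \<in> U) \<noteq> (d \<in> V)"] unfolding d_def[symmetric] by blast
      \<comment> \<open>Otherwise \<open>d\<close> is some \<open>j r\<close> in \<open>V\<close>,
        and \<open>d \<le> k < j s\<close> gives \<open>r < s\<close>; but all such
        \<open>j r\<close> were put into \<open>U\<close>.\<close>
      have "d \<in> U"
      proof (rule ccontr)
        assume "d \<notin> U"
        then obtain r where r: "r \<in> {1..q}" "d = j r" using d V by blast
        then have "r < s" using less[OF r(1) s(1)] dk kj by simp
        then have "j r \<in> ?B" using r(1) by simp
        then show False using r(2) U(1) \<open>d \<notin> U\<close> by blast
      qed
      then show ?thesis using U below d by blast
    qed
  qed
qed

text \<open>\<open>Inl t\<close> stands for \<open>A t\<close> and \<open>Inr F\<close> for the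
  complement of \<open>F\<close>. Two sets \<open>A s\<close> and \<open>A t\<close> are separated
  by \<open>j s\<close>, two complements by their equal size. No \<open>A s\<close> lies in a
  complement of \<open>F\<close>, since \<open>F\<close> meets \<open>A s\<close>; the remaining
  case is settled by counting.\<close>

lemma components_antichain:
  fixes j :: "nat \<Rightarrow> nat"
  assumes mono: "strict_mono_on {1..q} j" and j1: "1 \<le> j 1" and q: "1 \<le> q" and jq: "j q \<le> n"
    and A: "\<And>t. t \<in> {1..q} \<Longrightarrow> A t = {1..j t} - j ` {1..<t}"
    and Fs: "Fs = {F. F \<subseteq> {1..n} \<and> card F = q - 1 \<and> (\<forall>t\<in>{1..q}. F \<inter> A t \<noteq> {})}"
    and x: "x \<in> {1..q} <+> Fs" and y: "y \<in> {1..q} <+> Fs"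
    and sub: "case_sum A (\<lambda>F. {1..n} - F) x \<subseteq> case_sum A (\<lambda>F. {1..n} - F) y"
  shows "x = y"
proof -
  have less: "j s < j t \<longleftrightarrow> s < t" if "s \<in> {1..q}" "t \<in> {1..q}" for s t
    using strict_mono_on_less[OF mono that] .
  have inj: "inj_on j {1..q}" using mono by (rule strict_mono_on_imp_inj_on)
  have j_pos: "1 \<le> j t" if "t \<in> {1..q}" for t
    using less[of 1 t] j1 q that by (cases "t = 1") auto
  have j_le: "j t \<le> n" if "t \<in> {1..q}" for t
    using less[OF that, of q] jq q that by (cases "t = q") auto
  have j_A: "j t \<in> A t" if t: "t \<in> {1..q}" for t
    using j_pos[OF t] less[OF _ t] t by (fastforce simp: A[OF t])
  have A_sub: "A t \<subseteq> {1..n}" if "t \<in> {1..q}" for t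
    using A[OF that] j_le[OF that] by auto
  \<comment> \<open>\<open>A t\<close> avoids the other \<open>q - 1\<close> elements of
    \<open>V\<close>: the earlier ones are removed and the later ones exceed
    \<open>j t\<close>.\<close>
  have card_A: "card (A t) \<le> n - (q - 1)" if t: "t \<in> {1..q}" for t
  proof -
    have "A t \<inter> j ` ({1..q} - {t}) = {}"
      using A[OF t] less[OF t] by fastforce
    moreover have "j ` ({1..q} - {t}) \<subseteq> {1..n}" using j_pos j_le by fastforce
    ultimately have "card (A t) \<le> card ({1..n} - j ` ({1..q} - {t}))"
      using A_sub[OF t] by (intro card_mono) auto
    also have "\<dots> = n - card (j ` ({1..q} - {t}))"
      using \<open>j ` ({1..q} - {t}) \<subseteq> {1..n}\<close> by (subst card_Diff_subset) auto
    also have "card (j ` ({1..q} - {t})) = q - 1"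
      using inj_on_subset[OF inj, of "{1..q} - {t}"] t by (subst card_image) auto
    finally show ?thesis .
  qed
  have card_F: "card ({1..n} - F) = n - (q - 1)" if "F \<in> Fs" for F
    using that Fs finite_subset[of F "{1..n}"] by (subst card_Diff_subset) auto
  from x y show ?thesis
  proof (elim PlusE)
    fix s t assume st: "s \<in> {1..q}" "x = Inl s" "t \<in> {1..q}" "y = Inl t"
    then have "j s \<in> A t" using sub j_A by auto
    then have "j s \<le> j t" "j s \<notin> j ` {1..<t}" using A[OF st(3)] by auto
    then have "\<not> t < s" "\<not> s < t" using less[OF st(3,1)] st(1) by auto
    then show "x = y" using st by simp
  next
    fix s F assume "s \<in> {1..q}" "x = Inl s" "F \<in> Fs" "y = Inr F"
    then show "x = y" using sub Fs by auto
  next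
    fix F t assume Ft: "F \<in> Fs" "x = Inr F" "t \<in> {1..q}" "y = Inl t"
    then have "{1..n} - F \<subseteq> A t" using sub by simp
    moreover have "card (A t) \<le> card ({1..n} - F)" using card_A card_F Ft by simp
    \<comment> \<open>The complement of \<open>F\<close> is at least as large as \<open>A t\<close>,
      so inclusion forces equality; but then \<open>F\<close> would miss \<open>A t\<close>.\<close>
    ultimately have "{1..n} - F = A t"
      using A_sub[OF Ft(3)] by (intro card_seteq) (auto intro: finite_subset)
    then show "x = y" using Ft Fs by blast
  next
    fix F G assume FG: "F \<in> Fs" "x = Inr F" "G \<in> Fs" "y = Inr G"
    then have "{1..n} - F = {1..n} - G"
      using sub card_F by (intro card_seteq) auto
    moreover have "F \<subseteq> {1..n}" "G \<subseteq> {1..n}" using FG Fs by auto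
    ultimately have "F = G" by blast
    then show "x = y" using FG by simp
  qed
qed

section \<open>The decomposition of the lexsegment ideal\<close>

theorem theorem2p1:
  fixes n q :: nat
    and j :: "nat \<Rightarrow> nat"
    and v :: "nat \<Rightarrow>\<^sub>0 nat"
    and I :: "('k::field) mpol set"
    and A :: "nat \<Rightarrow> nat set"
    and Fs :: "nat set set"
  assumes "q \<ge> 2"
    and "2 \<le> j 1" and "strict_mono_on {1..q} j" and "j q \<le> n"
    and "v = (\<Sum>t=1..q. Poly_Mapping.single (j t) 1)"
    and "I = initial_sqfree_lexseg_ideal n q v"
    and "\<And>t. t \<in> {1..q} \<Longrightarrow> A t = {1..j t} - j ` {1..<t}"
    and "Fs = {F. F \<subseteq> {1..n} \<and> card F = q - 1 \<and> (\<forall>t\<in>{1..q}. F \<inter> A t \<noteq> {})}"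
  shows "I = (\<Inter>t\<in>{1..q}. var_ideal n (A t)) \<inter> (\<Inter>F\<in>Fs. var_ideal n ({1..n} - F))
    \<and> minimal_primary_decomposition (mpol_ring n) I ({1..q} <+> Fs)
        (case_sum (\<lambda>t. var_ideal n (A t)) (\<lambda>F. var_ideal n ({1..n} - F)))"
proof -
  let ?R = "mpol_ring n :: 'k mpol ring"
  let ?S = "case_sum A (\<lambda>F. {1..n} - F)"
  let ?C = "case_sum (\<lambda>t. var_ideal n (A t)) (\<lambda>F. var_ideal n ({1..n} - F)) :: _ \<Rightarrow> 'k mpol set"
  have q: "1 \<le> q" "1 \<in> {1..q}" and j1: "1 \<le> j 1" using assms(1,2) by auto
  define V where "V = j ` {1..q}"
  have finV: "finite V" by (simp add: V_def)
  have v: "v = (\<Sum>i\<in>V. Poly_Mapping.single i 1)"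
    unfolding assms(5) V_def
    using strict_mono_on_imp_inj_on[OF assms(3)] by (simp add: sum.reindex)
  have A_sub: "A t \<subseteq> {1..n}" if "t \<in> {1..q}" for t
    using assms(7)[OF that] strict_mono_on_leD[OF assms(3) that, of q] assms(4) that by auto
  have S_sub: "?S x \<subseteq> {1..n}" if "x \<in> {1..q} <+> Fs" for x
    using that by (rule PlusE) (use A_sub in simp_all)
  have C_S: "?C x = var_ideal n (?S x)" for x by (cases x) simp_all
  let ?M = "initial_sqfree_lexseg n q v"
  have M_keys: "Poly_Mapping.keys m \<subseteq> {1..n}" if "m \<in> ?M" for m
    using that by (simp add: initial_sqfree_lexseg_def sqfree_mons_def)
  \<comment> \<open>Lying in the ideals is a condition on each monomial separately, so the equality
    of ideals reduces to this statement about supports.\<close>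
  have mem: "m \<in> multiples ?M \<longleftrightarrow> (\<forall>t\<in>{1..q}. Poly_Mapping.keys m \<inter> A t \<noteq> {}) \<and>
      (\<forall>F\<in>Fs. Poly_Mapping.keys m \<inter> ({1..n} - F) \<noteq> {})" if m: "Poly_Mapping.keys m \<subseteq> {1..n}" for m
    unfolding v mem_multiples_sqfree_iff[OF finV] Int_absorb1[OF m]
    by (rule lexseg_support_iff[OF assms(3) j1 q(1) assms(4,7,8) V_def m])
  have "I = {p \<in> carrier ?R. Poly_Mapping.keys p \<subseteq> multiples ?M}"
    unfolding assms(6) initial_sqfree_lexseg_ideal_def by (rule monomial_ideal_eq[OF M_keys])
  also have "\<dots> = {p \<in> carrier ?R. \<forall>m\<in>Poly_Mapping.keys p.
      (\<forall>t\<in>{1..q}. Poly_Mapping.keys m \<inter> A t \<noteq> {}) \<and>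
      (\<forall>F\<in>Fs. Poly_Mapping.keys m \<inter> ({1..n} - F) \<noteq> {})}"
  proof (intro Collect_cong conj_cong refl)
    fix p assume "p \<in> carrier ?R"
    then have "Poly_Mapping.keys m \<subseteq> {1..n}" if "m \<in> Poly_Mapping.keys p" for m
      using that by (simp add: mpol_ring_simps)
    then show "Poly_Mapping.keys p \<subseteq> multiples ?M \<longleftrightarrow> (\<forall>m\<in>Poly_Mapping.keys p.
      (\<forall>t\<in>{1..q}. Poly_Mapping.keys m \<inter> A t \<noteq> {}) \<and>
      (\<forall>F\<in>Fs. Poly_Mapping.keys m \<inter> ({1..n} - F) \<noteq> {}))"
      unfolding subset_eq[of "Poly_Mapping.keys p"] by (intro ball_cong refl mem)
  qed
  also have "\<dots> = (\<Inter>t\<in>{1..q}. var_ideal n (A t)) \<inter> (\<Inter>F\<in>Fs. var_ideal n ({1..n} - F))"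
  proof -
    define meets :: "nat set \<Rightarrow> (nat \<Rightarrow>\<^sub>0 nat) \<Rightarrow> bool"
      where "meets B m \<longleftrightarrow> Poly_Mapping.keys m \<inter> B \<noteq> {}" for B m
    have var: "var_ideal n B = {p \<in> carrier ?R. \<forall>m\<in>Poly_Mapping.keys p. meets B m}"
      if "B \<subseteq> {1..n}" for B
      unfolding var_ideal_eq[OF that] meets_def by blast
    have A_eq: "(\<Inter>t\<in>{1..q}. var_ideal n (A t)) =
        (\<Inter>t\<in>{1..q}. {p \<in> carrier ?R. \<forall>m\<in>Poly_Mapping.keys p. meets (A t) m})"
      by (intro INF_cong refl var A_sub)
    have F_eq: "(\<Inter>F\<in>Fs. var_ideal n ({1..n} - F)) =
        (\<Inter>F\<in>Fs. {p \<in> carrier ?R. \<forall>m\<in>Poly_Mapping.keys p. meets ({1..n} - F) m})"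
      by (intro INF_cong refl var) blast
    \<comment> \<open>The index 1 keeps the first intersection nonempty, so that membership in the
      carrier follows even if \<open>Fs\<close> is empty.\<close>
    show ?thesis unfolding A_eq F_eq meets_def[symmetric] using q(2) by blast
  qed
  finally have I: "I = (\<Inter>t\<in>{1..q}. var_ideal n (A t)) \<inter> (\<Inter>F\<in>Fs. var_ideal n ({1..n} - F))" .
  have "minimal_primary_decomposition ?R I ({1..q} <+> Fs) ?C"
  proof (rule minimal_primary_decompositionI)
    have "finite Fs" unfolding assms(8) by (rule finite_subset[of _ "Pow {1..n}"]) auto
    then show "finite ({1..q} <+> Fs)" by simp
    show "primeideal (?C x) ?R" if "x \<in> {1..q} <+> Fs" for x
      unfolding C_S by (rule primeideal_var_ideal[OF S_sub[OF that]])
    show "x = y" if x: "x \<in> {1..q} <+> Fs" and y: "y \<in> {1..q} <+> Fs" and "?C x \<subseteq> ?C y" for x y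
    proof (rule components_antichain[OF assms(3) j1 q(1) assms(4,7,8) x y])
      show "?S x \<subseteq> ?S y"
        using \<open>?C x \<subseteq> ?C y\<close> unfolding C_S var_ideal_subset_iff[OF S_sub[OF x] S_sub[OF y]] .
    qed
    have "var_ideal n (A 1) \<subseteq> carrier ?R"
      unfolding var_ideal_eq[OF A_sub[OF q(2)]] by blast
    then show "I = carrier ?R \<inter> (\<Inter>x\<in>{1..q} <+> Fs. ?C x)"
      using q(2) unfolding I Plus_def INF_union image_image sum.case image_comp comp_def by blast
  qed
  with I show ?thesis by blast
qed

end
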